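(* Let $q\ge 1$ be an integer, let $2\le p<\infty$, and let $w:\mathbb{D}\to(0,\infty)$ be a weight for which there exist a constant $C>0$, a non-negative integer $k$ and $r_0\in(0,1)$ such that $$r^k\,w\left(\frac{z}{r}\right)\le C\,w(z)\quad\text{for all } r_0\le r<1 \text{ and all } z \text{ with } |z|<r.$$ Then the polyanalytic polynomials (those belonging to $\mathcal{B}^p_{q,w}$) are dense in the weighted polyanalytic Besov space $\mathcal{B}^p_{q,w}$: for every $f\in\mathcal{B}^p_{q,w}$ and every $\varepsilon>0$ there is a $q$-analytic polynomial $P\in\mathcal{B}^p_{q,w}$ with $\|f-P\|_{\mathcal{B}^p_{q,w}}<\varepsilon$.
   Context: $\mathbb{D}=\{z\in\mathbb{C}:|z|<1\}$ and $dA$ is area measure. For $z=x+iy$, $\partial_z f=\frac12\left(\frac{\partial f}{\partial x}-i\frac{\partial f}{\partial y}\right)$ and $\partial_{\overline z} f=\frac12\left(\frac{\partial f}{\partial x}+i\frac{\partial f}{\partial y}\right)$. A function $f:\mathbb{D}\to\mathbb{C}$ is $q$-analytic if $f\in C^q(\mathbb{D})$ and $\left(\partial_{\overline z}\right)^q f=0$ on $\mathbb{D}$. A weight on $\mathbb{D}$ is a positive function that is integrable on $\mathbb{D}$ with respect to $dA$. The weighted polyanalytic Besov space $\mathcal{B}^p_{q,w}$ is the set of $q$-analytic functions $f$ on $\mathbb{D}$ for which $$\|f\|_{\mathcal{B}^p_{q,w}}=\left(|f(0)|^p+\int_{\mathbb{D}}(1-|z|^2)^{p-2}\left[|\partial_z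 f(z)|^p+|\partial_{\overline z}f(z)|^p\right]w(z)\,dA(z)\right)^{1/p}<\infty.$$ A polyanalytic polynomial is a finite sum $\sum_{i,j}c_{i,j}z^i\overline z^j$ with $c_{i,j}\in\mathbb{C}$; it is $q$-analytic exactly when its degree in $\overline z$ is at most $q-1$. *)

theory Defs
  imports "HOL-Analysis.Analysis"
begin

text \<open>
  Functions on the unit disc are total functions on the complex plane of which only the
  values on \<open>ball 0 1\<close> matter. Since the disc is open, the derivatives below at points of
  the disc do not depend on the values outside it.
\<close>

definition partial_x :: "(complex \<Rightarrow> complex) \<Rightarrow> complex \<Rightarrow> complex" where
  "partial_x f z = vector_derivative (\<lambda>t. f (z + complex_of_real t)) (at 0)"

definition partial_y :: "(complex \<Rightarrow> complex) \<Rightarrow> complex \<Rightarrow> complex" where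
  "partial_y f z = vector_derivative (\<lambda>t. f (z + \<i> * complex_of_real t)) (at 0)"

definition d_z :: "(complex \<Rightarrow> complex) \<Rightarrow> complex \<Rightarrow> complex" where
  "d_z f z = (partial_x f z - \<i> * partial_y f z) / 2"

definition d_zbar :: "(complex \<Rightarrow> complex) \<Rightarrow> complex \<Rightarrow> complex" where
  "d_zbar f z = (partial_x f z + \<i> * partial_y f z) / 2"

text \<open>
  The class \<open>C\<^sup>k\<close> in the sense of the real variables \<open>x\<close> and \<open>y\<close>; the set is meant to be open.
  \<open>differentiable\<close> is Frechet differentiability over the reals.
\<close>

primrec Ck_on :: "nat \<Rightarrow> (complex \<Rightarrow> complex) \<Rightarrow> complex set \<Rightarrow> bool" where
  "Ck_on 0 f S \<longleftrightarrow> continuous_on S f"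
| "Ck_on (Suc k) f S \<longleftrightarrow>
     (\<forall>z\<in>S. f differentiable (at z)) \<and> Ck_on k (partial_x f) S \<and> Ck_on k (partial_y f) S"

definition q_analytic :: "nat \<Rightarrow> (complex \<Rightarrow> complex) \<Rightarrow> bool" where
  "q_analytic q f \<longleftrightarrow> Ck_on q f (ball 0 1) \<and> (\<forall>z\<in>ball 0 1. (d_zbar ^^ q) f z = 0)"

definition weight :: "(complex \<Rightarrow> real) \<Rightarrow> bool" where
  "weight w \<longleftrightarrow> (\<forall>z\<in>ball 0 1. 0 < w z) \<and> set_integrable lebesgue (ball 0 1) w"

definition besov_integral ::
  "real \<Rightarrow> (complex \<Rightarrow> real) \<Rightarrow> (complex \<Rightarrow> complex) \<Rightarrow> ennreal" where
  "besov_integral p w f =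
     (\<integral>\<^sup>+z\<in>ball 0 1. ennreal ((1 - (cmod z)\<^sup>2) powr (p - 2) *
        (cmod (d_z f z) powr p + cmod (d_zbar f z) powr p) * w z) \<partial>lebesgue)"

text \<open>
  The norm takes the value \<open>\<infinity>\<close> when the integral diverges; the case distinction is needed
  because there is no real power on \<open>ennreal\<close>.
\<close>

definition besov_norm ::
  "real \<Rightarrow> (complex \<Rightarrow> real) \<Rightarrow> (complex \<Rightarrow> complex) \<Rightarrow> ennreal" where
  "besov_norm p w f =
     (if besov_integral p w f = \<infinity> then \<infinity>
      else ennreal ((cmod (f 0) powr p + enn2real (besov_integral p w f)) powr (1 / p)))"

definition besov_space ::
  "nat \<Rightarrow> real \<Rightarrow> (complex \<Rightarrow> real) \<Rightarrow> (complex \<Rightarrow> complex) set" where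
  "besov_space q p w = {f. q_analytic q f \<and> besov_norm p w f < \<infinity>}"

definition polyanalytic_polynomial :: "(complex \<Rightarrow> complex) \<Rightarrow> bool" where
  "polyanalytic_polynomial P \<longleftrightarrow>
     (\<exists>(I :: (nat \<times> nat) set) (c :: nat \<Rightarrow> nat \<Rightarrow> complex).
        finite I \<and> P = (\<lambda>z. \<Sum>(i, j)\<in>I. c i j * z ^ i * cnj z ^ j))"

end

theory Submission
  imports Defs "HOL-Complex_Analysis.Complex_Analysis"
begin

text \<open>
  A \<open>q\<close>-analytic function on the disc has the form \<open>f z = (\<Sum>j<q. cnj z ^ j * h j z)\<close> with
  holomorphic \<open>h j\<close> (lemma \<open>polyanalytic_decomposition\<close>). It is approximated in two steps, with
  the dilations \<open>z \<mapsto> f (r z)\<close>, \<open>r < 1\<close>, in between.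

  The dilations converge to \<open>f\<close> in the seminorm as \<open>r\<close> tends to \<open>1\<close>. On a smaller disc their
  first derivatives converge uniformly. Near the boundary nothing is known about \<open>f\<close> beyond the
  finiteness of the integral; but the hypothesis on the weight says that, after the
  substitution \<open>u = r z\<close>, the dilated weight is bounded by a constant times the original one. The
  dilations therefore carry as little mass near the boundary as \<open>f\<close> does, up to a constant
  (lemma \<open>dilation_Lp_convergence\<close>).

  A dilation is close to a polynomial, uniformly on the disc together with its first derivatives,
  because its coefficients \<open>r ^ j * h j (r z)\<close> are holomorphic beyond the closed disc and may be
  replaced by polynomials (lemma \<open>dilation_poly_approx\<close>). Replacing coefficients keeps the degree
  in \<open>cnj z\<close> below \<open>q\<close>, and as the weight is integrable, uniform closeness of the derivatives
  implies closeness in the seminorm. The value at the origin is matched exactly, so that the first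
  term of the norm vanishes.
\<close>

section \<open>Wirtinger derivatives\<close>

lemma partial_eq_wirtinger:
  "partial_x f z = d_z f z + d_zbar f z" "partial_y f z = \<i> * (d_z f z - d_zbar f z)"
  by (simp_all add: d_z_def d_zbar_def field_simps)

lemma has_derivative_imp_partial:
  assumes "(f has_derivative D) (at z)"
  shows "partial_x f z = D 1" "partial_y f z = D \<i>"
proof -
  have *: "vector_derivative (\<lambda>t. f (z + e * complex_of_real t)) (at 0) = D e" for e
  proof -
    have "((\<lambda>t. z + e * complex_of_real t) has_derivative (\<lambda>t. e * complex_of_real t)) (at 0)"
      by (auto intro!: derivative_eq_intros)
    moreover have "(f has_derivative D) (at (z + e * complex_of_real 0))"
      using assms by simp
    ultimately have "(f \<circ> (\<lambda>t. z + e * complex_of_real t) has_derivative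
        D \<circ> (\<lambda>t. e * complex_of_real t)) (at 0)"
      by (rule diff_chain_at)
    moreover have "D \<circ> (\<lambda>t. e * complex_of_real t) = (\<lambda>t. t *\<^sub>R D e)"
    proof
      fix t
      interpret bounded_linear D using assms by (rule has_derivative_bounded_linear)
      have "e * complex_of_real t = t *\<^sub>R e" by (simp add: scaleR_conv_of_real)
      then show "(D \<circ> (\<lambda>t. e * complex_of_real t)) t = t *\<^sub>R D e" by (simp add: scaleR)
    qed
    ultimately show ?thesis
      by (intro vector_derivative_at) (simp add: has_vector_derivative_def o_def)
  qed
  show "partial_x f z = D 1" using *[of 1] by (simp add: partial_x_def)
  show "partial_y f z = D \<i>" using *[of \<i>] by (simp add: partial_y_def)
qed

text \<open>
  Every real-linear map of the plane is \<open>v \<mapsto> a v + b cnj v\<close> for a unique pair \<open>a\<close>, \<open>b\<close>. The next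
  two lemmas identify this pair for the total derivative with the two Wirtinger derivatives, so
  that product and chain rules can be taken from the calculus of \<open>has_derivative\<close>.
\<close>

lemma has_derivative_imp_wirtinger:
  assumes "(f has_derivative (\<lambda>v. a * v + b * cnj v)) (at z)"
  shows "d_z f z = a" "d_zbar f z = b"
proof -
  have x: "partial_x f z = a + b" and y: "partial_y f z = \<i> * (a - b)"
    using has_derivative_imp_partial[OF assms] by (simp_all add: algebra_simps)
  show "d_z f z = a" "d_zbar f z = b"
    unfolding d_z_def d_zbar_def x y by (simp_all add: algebra_simps)
qed

lemma has_derivative_wirtinger:
  assumes "f differentiable (at z)"
  shows "(f has_derivative (\<lambda>v. d_z f z * v + d_zbar f z * cnj v)) (at z)"
proof -
  obtain D where D: "(f has_derivative D) (at z)"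
    using assms by (auto simp: differentiable_def)
  interpret bounded_linear D using D by (rule has_derivative_bounded_linear)
  have "D v = d_z f z * v + d_zbar f z * cnj v" for v
  proof -
    have "v = Re v *\<^sub>R 1 + Im v *\<^sub>R \<i>" by (simp add: complex_eq_iff)
    then have "D v = D (Re v *\<^sub>R 1 + Im v *\<^sub>R \<i>)" by simp
    also have "\<dots> = Re v *\<^sub>R D 1 + Im v *\<^sub>R D \<i>" by (simp only: add scaleR)
    also have "\<dots> = d_z f z * v + d_zbar f z * cnj v"
      unfolding d_z_def d_zbar_def has_derivative_imp_partial[OF D]
      by (simp add: complex_eq_iff algebra_simps) (simp add: field_simps)
    finally show ?thesis .
  qed
  then have "D = (\<lambda>v. d_z f z * v + d_zbar f z * cnj v)" by auto
  with D show ?thesis by simp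
qed

lemma wirtinger_cong:
  assumes "open S" "z \<in> S" "\<And>z. z \<in> S \<Longrightarrow> f z = g z"
  shows "partial_x f z = partial_x g z" "partial_y f z = partial_y g z"
    "d_z f z = d_z g z" "d_zbar f z = d_zbar g z"
proof -
  have *: "vector_derivative (\<lambda>t. f (z + e * complex_of_real t)) (at 0) =
      vector_derivative (\<lambda>t. g (z + e * complex_of_real t)) (at 0)" for e
  proof (rule vector_derivative_cong_eq)
    have "open ((\<lambda>t. z + e * complex_of_real t) -` S)"
      using assms(1) by (intro open_vimage continuous_intros)
    then have "\<forall>\<^sub>F t in nhds 0. z + e * complex_of_real t \<in> S"
      unfolding eventually_nhds using assms(2) by (intro exI[of _ "(\<lambda>t. z + e * complex_of_real t) -` S"]) auto
    then show "\<forall>\<^sub>F t in nhds 0. t \<in> UNIV \<longrightarrow> f (z + e * complex_of_real t) = g (z + e * complex_of_real t)"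
      by eventually_elim (use assms in auto)
  qed auto
  show x: "partial_x f z = partial_x g z" using *[of 1] by (simp add: partial_x_def)
  show y: "partial_y f z = partial_y g z" using *[of \<i>] by (simp add: partial_y_def)
  show "d_z f z = d_z g z" "d_zbar f z = d_zbar g z"
    by (simp_all add: d_z_def d_zbar_def x y)
qed

lemma wirtinger_diff:
  assumes "f differentiable (at z)" "g differentiable (at z)"
  shows "d_z (\<lambda>x. f x - g x) z = d_z f z - d_z g z"
    "d_zbar (\<lambda>x. f x - g x) z = d_zbar f z - d_zbar g z"
proof -
  have "((\<lambda>x. f x - g x) has_derivative
     (\<lambda>v. (d_z f z - d_z g z) * v + (d_zbar f z - d_zbar g z) * cnj v)) (at z)"
    using has_derivative_diff[OF assms[THEN has_derivative_wirtinger]]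
    by (simp add: algebra_simps)
  then show "d_z (\<lambda>x. f x - g x) z = d_z f z - d_z g z"
    "d_zbar (\<lambda>x. f x - g x) z = d_zbar f z - d_zbar g z"
    by (auto dest: has_derivative_imp_wirtinger)
qed

lemma Ck_on_imp_continuous_on: "Ck_on k f S \<Longrightarrow> continuous_on S f"
  by (cases k) (auto intro!: continuous_at_imp_continuous_on differentiable_imp_continuous_within)

lemma Ck_on_cong:
  assumes "open S" "\<And>z. z \<in> S \<Longrightarrow> f z = g z" "Ck_on k f S"
  shows "Ck_on k g S"
  using assms(2,3)
proof (induction k arbitrary: f g)
  case 0
  then show ?case using continuous_on_cong[of S S f g] by simp
next
  case (Suc k)
  have "g differentiable at z" if "z \<in> S" for z
  proof -
    have "f differentiable at z" using Suc.prems(2) that by simp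
    then obtain D where "(f has_derivative D) (at z)" by (auto simp: differentiable_def)
    then have "(g has_derivative D) (at z)"
      by (rule has_derivative_transform_within_open) (use assms(1) that Suc.prems(1) in auto)
    then show ?thesis by (auto simp: differentiable_def)
  qed
  then show ?case
    using Suc.IH[of "partial_x f" "partial_x g"] Suc.IH[of "partial_y f" "partial_y g"]
      wirtinger_cong[OF assms(1), of _ f g] Suc.prems by simp
qed

text \<open>
  The partial derivatives of a linear combination are known only at the points of \<open>S\<close>, which is
  why the induction has to pass through \<open>Ck_on_cong\<close>.
\<close>

lemma Ck_on_linear:
  assumes "open S" "Ck_on k f S" "Ck_on k g S"
  shows "Ck_on k (\<lambda>z. a * f z + b * g z) S"
  using assms(2,3)
proof (induction k arbitrary: f g)
  case 0
  then show ?case by (auto intro!: continuous_intros)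
next
  case (Suc k)
  have D: "((\<lambda>z. a * f z + b * g z) has_derivative
      (\<lambda>v. (a * d_z f z + b * d_z g z) * v + (a * d_zbar f z + b * d_zbar g z) * cnj v)) (at z)"
    if "z \<in> S" for z
  proof -
    have "f differentiable (at z)" "g differentiable (at z)" using Suc.prems that by auto
    note * = this[THEN has_derivative_wirtinger]
    show ?thesis by (rule derivative_eq_intros * refl)+ (auto simp: algebra_simps)
  qed
  have eq: "a * partial_x f z + b * partial_x g z = partial_x (\<lambda>z. a * f z + b * g z) z"
     "a * partial_y f z + b * partial_y g z = partial_y (\<lambda>z. a * f z + b * g z) z"
     if "z \<in> S" for z
    by (simp_all add: partial_eq_wirtinger has_derivative_imp_wirtinger[OF D[OF that]]
        algebra_simps)
  have "Ck_on k (partial_x (\<lambda>z. a * f z + b * g z)) S"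
    by (rule Ck_on_cong[OF assms(1) eq(1)]) (use Suc in auto)
  moreover have "Ck_on k (partial_y (\<lambda>z. a * f z + b * g z)) S"
    by (rule Ck_on_cong[OF assms(1) eq(2)]) (use Suc in auto)
  ultimately show ?case using D by (auto simp: differentiable_def)
qed

lemma Ck_on_wirtinger:
  assumes "open S" "Ck_on (Suc k) f S"
  shows "Ck_on k (d_z f) S" "Ck_on k (d_zbar f) S"
proof -
  have "d_z f = (\<lambda>z. (1/2) * partial_x f z + (- \<i>/2) * partial_y f z)"
    "d_zbar f = (\<lambda>z. (1/2) * partial_x f z + (\<i>/2) * partial_y f z)"
    by (auto simp: d_z_def d_zbar_def field_simps)
  then show "Ck_on k (d_z f) S" "Ck_on k (d_zbar f) S"
    using assms by (simp_all only: Ck_on.simps Ck_on_linear)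
qed

text \<open>
  When the derivative in \<open>cnj z\<close> vanishes, the real derivative \<open>v \<mapsto> a v + b cnj v\<close> has \<open>b = 0\<close>, hence is
  multiplication by a complex number: these are the Cauchy-Riemann equations.
\<close>

lemma holomorphic_on_if_d_zbar:
  assumes "open S" "\<And>z. z \<in> S \<Longrightarrow> f differentiable (at z)" "\<And>z. z \<in> S \<Longrightarrow> d_zbar f z = 0"
  shows "f holomorphic_on S"
proof -
  have "(f has_field_derivative d_z f z) (at z)" if "z \<in> S" for z
    using has_derivative_wirtinger[OF assms(2)[OF that]] assms(3)[OF that]
    by (simp add: has_field_derivative_def)
  then show ?thesis using assms(1) by (auto simp: holomorphic_on_open)
qed

section \<open>Functions polynomial in the conjugate variable\<close>

definition zbar_comb :: "nat \<Rightarrow> (nat \<Rightarrow> complex \<Rightarrow> complex) \<Rightarrow> complex \<Rightarrow> complex" where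
  "zbar_comb n h z = (\<Sum>j<n. cnj z ^ j * h j z)"

lemma has_derivative_zbar_comb:
  assumes "\<And>j. (h j has_field_derivative h' j) (at z)"
  shows "(zbar_comb n h has_derivative
    (\<lambda>v. (\<Sum>j<n. cnj z ^ j * h' j) * v + (\<Sum>j<n. of_nat j * cnj z ^ (j - 1) * h j z) * cnj v)) (at z)"
  unfolding zbar_comb_def
  by (rule derivative_eq_intros assms[THEN has_field_derivative_imp_has_derivative] refl)+
     (auto simp: fun_eq_iff sum_distrib_left sum.distrib algebra_simps)

lemma wirtinger_zbar_comb:
  assumes "\<And>j. h j holomorphic_on S" "open S" "z \<in> S"
  shows "zbar_comb n h differentiable (at z)"
    "d_z (zbar_comb n h) z = zbar_comb n (\<lambda>j. deriv (h j)) z"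
    "d_zbar (zbar_comb n h) z = (\<Sum>j<n. of_nat j * cnj z ^ (j - 1) * h j z)"
proof -
  have "(h j has_field_derivative deriv (h j) z) (at z)" for j
    using assms holomorphic_derivI by blast
  note D = has_derivative_zbar_comb[of h "\<lambda>j. deriv (h j) z", OF this, of n]
  show "zbar_comb n h differentiable (at z)" using D by (auto simp: differentiable_def)
  show "d_z (zbar_comb n h) z = zbar_comb n (\<lambda>j. deriv (h j)) z"
    "d_zbar (zbar_comb n h) z = (\<Sum>j<n. of_nat j * cnj z ^ (j - 1) * h j z)"
    using has_derivative_imp_wirtinger[OF D] by (simp_all add: zbar_comb_def)
qed

text \<open>
  The structure theorem for polyanalytic functions, by induction on the order. If \<open>f\<close> has
  order \<open>q + 1\<close>, then \<open>d_zbar f\<close> has order \<open>q\<close>, so it is \<open>\<Sum>j<q. cnj z ^ j * h j z\<close> with holomorphic \<open>h j\<close>.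
  Integrating formally in \<open>cnj z\<close> gives \<open>\<Sum>j<q. cnj z ^ (j + 1) / (j + 1) * h j z\<close>, which has the
  same derivative in \<open>cnj z\<close> as \<open>f\<close>; the difference is therefore holomorphic and is the
  coefficient of \<open>cnj z ^ 0\<close>.
\<close>

lemma polyanalytic_decomposition:
  assumes "open S" "Ck_on q f S" "\<And>z. z \<in> S \<Longrightarrow> (d_zbar ^^ q) f z = 0"
  obtains h where "\<And>j. h j holomorphic_on S" "\<And>z. z \<in> S \<Longrightarrow> f z = zbar_comb q h z"
proof -
  have "\<exists>h. (\<forall>j. h j holomorphic_on S) \<and> (\<forall>z\<in>S. f z = zbar_comb q h z)"
    using assms(2,3)
  proof (induction q arbitrary: f)
    case 0
    then show ?case by (intro exI[of _ "\<lambda>_ _. 0"]) (auto simp: zbar_comb_def)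
  next
    case (Suc q)
    have "Ck_on q (d_zbar f) S" by (rule Ck_on_wirtinger[OF assms(1) Suc.prems(1)])
    moreover have "(d_zbar ^^ q) (d_zbar f) z = 0" if "z \<in> S" for z
      using Suc.prems(2)[OF that] by (simp add: funpow_swap1)
    ultimately obtain h where h: "\<And>j. h j holomorphic_on S"
      "\<And>z. z \<in> S \<Longrightarrow> d_zbar f z = zbar_comb q h z"
      using Suc.IH by blast
    define H where "H j = (case j of 0 \<Rightarrow> \<lambda>_. 0 | Suc i \<Rightarrow> \<lambda>z. h i z / of_nat (Suc i))" for j
    have H: "H j holomorphic_on S" for j
      by (cases j) (auto simp: H_def simp del: of_nat_Suc intro!: holomorphic_intros h)
    note HD = wirtinger_zbar_comb[OF H assms(1), of _ "Suc q"]
    define g where "g z = f z - zbar_comb (Suc q) H z" for z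
    have "g holomorphic_on S"
    proof (rule holomorphic_on_if_d_zbar)
      fix z assume z: "z \<in> S"
      have f: "f differentiable (at z)" using Suc.prems(1) z by simp
      show "g differentiable (at z)"
        unfolding g_def using f HD(1)[OF z] by (rule differentiable_diff)
      have "d_zbar (zbar_comb (Suc q) H) z = zbar_comb q h z"
        unfolding HD(3)[OF z] zbar_comb_def
        by (subst sum.lessThan_Suc_shift) (simp add: H_def del: of_nat_Suc)
      then show "d_zbar g z = 0"
        unfolding g_def wirtinger_diff(2)[OF f HD(1)[OF z]] using h(2)[OF z] by simp
    qed (rule assms(1))
    define G where "G j = (if j = 0 then g else H j)" for j
    have "G j holomorphic_on S" for j
      using H \<open>g holomorphic_on S\<close> by (simp add: G_def)
    moreover have "f z = zbar_comb (Suc q) G z" for z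
    proof -
      have "zbar_comb (Suc q) G z = g z + zbar_comb (Suc q) H z"
        unfolding zbar_comb_def
        by (subst (1 2) sum.lessThan_Suc_shift) (simp add: G_def H_def)
      then show ?thesis by (simp add: g_def)
    qed
    ultimately show ?case by blast
  qed
  then show ?thesis using that by blast
qed

abbreviation zbar_poly :: "nat \<Rightarrow> (nat \<Rightarrow> complex poly) \<Rightarrow> complex \<Rightarrow> complex" where
  "zbar_poly n p \<equiv> zbar_comb n (\<lambda>j. poly (p j))"

lemma wirtinger_zbar_poly:
  "d_z (zbar_poly n p) = zbar_poly n (\<lambda>j. pderiv (p j))"
  "d_zbar (zbar_poly n p) = zbar_poly (n - 1) (\<lambda>j. smult (of_nat (Suc j)) (p (Suc j)))"
  "zbar_poly n p differentiable (at z)"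
proof -
  have D: "(zbar_poly n p has_derivative
    (\<lambda>v. (\<Sum>j<n. cnj z ^ j * poly (pderiv (p j)) z) * v + (\<Sum>j<n. of_nat j * cnj z ^ (j - 1) * poly (p j) z) * cnj v)) (at z)" for z
    by (rule has_derivative_zbar_comb) (rule poly_DERIV)
  show "zbar_poly n p differentiable (at z)"
    using D by (auto simp: differentiable_def)
  show "d_z (zbar_poly n p) = zbar_poly n (\<lambda>j. pderiv (p j))"
    using has_derivative_imp_wirtinger(1)[OF D] by (auto simp: zbar_comb_def)
  have "(\<Sum>j<n. of_nat j * cnj z ^ (j - 1) * poly (p j) z) =
     zbar_poly (n - 1) (\<lambda>j. smult (of_nat (Suc j)) (p (Suc j))) z" for z
  proof (cases n)
    case (Suc m)
    show ?thesis unfolding Suc zbar_comb_def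
      by (subst sum.lessThan_Suc_shift) (simp add: algebra_simps)
  qed (simp add: zbar_comb_def)
  then show "d_zbar (zbar_poly n p) = zbar_poly (n - 1) (\<lambda>j. smult (of_nat (Suc j)) (p (Suc j)))"
    using has_derivative_imp_wirtinger(2)[OF D] by auto
qed

text \<open>
  Differentiating in \<open>cnj z\<close> drops one power of \<open>cnj z\<close>. Padding with zero coefficients puts both
  derivatives of a polynomial into a class of fixed length, as needed to add them up.
\<close>

lemma zbar_poly_zero_extend:
  assumes "m \<le> n"
  shows "zbar_poly m p = zbar_poly n (\<lambda>j. if j < m then p j else 0)"
proof
  fix z
  have "(\<Sum>j<n. cnj z ^ j * poly (if j < m then p j else 0) z) = (\<Sum>j<m. cnj z ^ j * poly (p j) z)"
    by (rule sum.mono_neutral_cong_right) (use assms in auto)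
  then show "zbar_poly m p z = zbar_poly n (\<lambda>j. if j < m then p j else 0) z"
    by (simp add: zbar_comb_def)
qed

lemma continuous_on_zbar_poly: "continuous_on S (zbar_poly n p)"
  unfolding zbar_comb_def by (intro continuous_intros)

lemma Ck_on_zbar_poly: "Ck_on k (zbar_poly n p) S"
proof (induction k arbitrary: p)
  case 0
  show ?case by (simp add: continuous_on_zbar_poly)
next
  case (Suc k)
  define p1 where "p1 = (\<lambda>j. pderiv (p j))"
  define p2 where "p2 = (\<lambda>j. if j < n - 1 then smult (of_nat (Suc j)) (p (Suc j)) else 0)"
  have d: "d_z (zbar_poly n p) = zbar_poly n p1" "d_zbar (zbar_poly n p) = zbar_poly n p2"
    unfolding wirtinger_zbar_poly p1_def p2_def
    by (rule refl, rule zbar_poly_zero_extend) simp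
  have "partial_x (zbar_poly n p) = zbar_poly n (\<lambda>j. p1 j + p2 j)"
    unfolding partial_eq_wirtinger[abs_def] d
    by (auto simp: zbar_comb_def algebra_simps sum.distrib)
  moreover have "partial_y (zbar_poly n p) = zbar_poly n (\<lambda>j. smult \<i> (p1 j - p2 j))"
    unfolding partial_eq_wirtinger[abs_def] d
    by (auto simp: zbar_comb_def algebra_simps sum_subtractf sum_distrib_left)
  ultimately show ?case
    by (simp add: Suc.IH wirtinger_zbar_poly(3))
qed

lemma d_zbar_funpow_zbar_poly: "(d_zbar ^^ n) (zbar_poly n p) z = 0"
proof (induction n arbitrary: p)
  case 0
  show ?case by (simp add: zbar_comb_def)
next
  case (Suc n)
  show ?case
    by (simp add: funpow_swap1 wirtinger_zbar_poly(2) Suc.IH del: of_nat_Suc)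
qed

lemma q_analytic_zbar_poly: "q_analytic q (zbar_poly q p)"
  by (simp add: q_analytic_def Ck_on_zbar_poly d_zbar_funpow_zbar_poly)

lemma polyanalytic_polynomial_zbar_poly: "polyanalytic_polynomial (zbar_poly n p)"
proof -
  define N where "N = Max ((\<lambda>j. degree (p j)) ` {..<n})"
  have "zbar_poly n p z = (\<Sum>(i, j)\<in>{..N} \<times> {..<n}. coeff (p j) i * z ^ i * cnj z ^ j)" for z
  proof -
    have "poly (p j) z = (\<Sum>i\<le>N. coeff (p j) i * z ^ i)" if "j < n" for j
    proof -
      have "degree (p j) \<le> N" unfolding N_def using that by (intro Max_ge) auto
      then show ?thesis
        unfolding poly_altdef by (intro sum.mono_neutral_left) (auto simp: coeff_eq_0)
    qed
    then have "zbar_poly n p z = (\<Sum>j<n. \<Sum>i\<le>N. coeff (p j) i * z ^ i * cnj z ^ j)"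
      by (simp add: zbar_comb_def sum_distrib_left algebra_simps)
    also have "\<dots> = (\<Sum>i\<le>N. \<Sum>j<n. coeff (p j) i * z ^ i * cnj z ^ j)"
      by (rule sum.swap)
    finally show ?thesis by (simp add: sum.cartesian_product)
  qed
  then show ?thesis
    unfolding polyanalytic_polynomial_def
    by (intro exI[of _ "{..N} \<times> {..<n}"] exI[of _ "\<lambda>i j. coeff (p j) i"]) auto
qed

section \<open>Polynomial approximation with first derivatives\<close>

lemma poly_antiderivative:
  fixes p :: "'a :: field_char_0 poly"
  obtains P where "pderiv P = p" "poly P 0 = c"
proof
  let ?P = "[:c:] + (\<Sum>i\<le>degree p. monom (coeff p i / of_nat (Suc i)) (Suc i))"
  have "pderiv ?P = (\<Sum>i\<le>degree p. monom (coeff p i) i)"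
    by (simp add: pderiv_add higher_pderiv_sum[where n = 1, simplified] pderiv_monom pderiv_pCons del: of_nat_Suc)
  then show "pderiv ?P = p" by (simp add: poly_as_sum_of_monoms)
  show "poly ?P 0 = c" by (simp add: poly_sum poly_monom)
qed

lemma holomorphic_uniform_poly_approx:
  assumes "h holomorphic_on ball 0 R" "1 < R" "0 < e"
  obtains p where "\<And>z. z \<in> cball 0 1 \<Longrightarrow> cmod (h z - poly p z) < e"
proof -
  define a where "a n = (deriv ^^ n) h 0 / fact n" for n
  have s: "(\<lambda>n. a n * z ^ n) sums h z" if "z \<in> ball 0 R" for z
    using holomorphic_power_series[OF assms(1) that] by (simp add: a_def)
  have "ereal R \<le> conv_radius a"
  proof (rule conv_radius_geI_ex)
    fix r assume "0 < r" "ereal r < ereal R"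
    then show "\<exists>z. norm z = r \<and> summable (\<lambda>n. a n * z ^ n)"
      by (intro exI[of _ "of_real r"]) (auto intro!: sums_summable[OF s])
  qed
  with assms(2) have "ereal 1 < conv_radius a"
    by (metis ereal_less(3) less_le_trans ereal_less_eq(3) less_ereal.simps(1))
  from powser_uniform_limit[OF this, of 0]
  have "\<forall>\<^sub>F n in sequentially. \<forall>z\<in>cball 0 1.
      dist (\<Sum>i<n. a i * (z - 0) ^ i) (\<Sum>i. a i * (z - 0) ^ i) < e"
    using assms(3) by (simp add: uniform_limit_iff)
  then obtain n where n: "\<And>z. z \<in> cball 0 1 \<Longrightarrow>
      dist (\<Sum>i<n. a i * z ^ i) (\<Sum>i. a i * z ^ i) < e"
    unfolding eventually_sequentially diff_zero by blast
  show ?thesis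
  proof
    fix z :: complex assume z: "z \<in> cball 0 1"
    then have "z \<in> ball 0 R" using assms(2) by auto
    then show "cmod (h z - poly (\<Sum>i<n. monom (a i) i) z) < e"
      using n[OF z] s[of z] by (simp add: poly_sum poly_monom dist_norm sums_iff norm_minus_commute)
  qed
qed

text \<open>
  It is the derivative that is approximated; an antiderivative of the approximating polynomial is
  then automatically close to \<open>h\<close>, because points of the disc have distance at most \<open>1\<close> from
  the origin, where the two functions are made to agree.
\<close>

lemma holomorphic_C1_poly_approx:
  assumes h: "h holomorphic_on ball 0 R" and R: "1 < R" and e: "0 < e"
  obtains p where "poly p 0 = h 0"
    "\<And>z. z \<in> cball 0 1 \<Longrightarrow> cmod (h z - poly p z) \<le> e"
    "\<And>z. z \<in> cball 0 1 \<Longrightarrow> cmod (deriv h z - poly (pderiv p) z) \<le> e"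
proof -
  obtain d where d: "\<And>z. z \<in> cball 0 1 \<Longrightarrow> cmod (deriv h z - poly d z) < e"
    using holomorphic_uniform_poly_approx[OF holomorphic_deriv[OF h open_ball] R e] by blast
  obtain p where p: "pderiv p = d" "poly p 0 = h 0" by (rule poly_antiderivative)
  show ?thesis
  proof
    show "poly p 0 = h 0" by fact
    show D: "cmod (deriv h z - poly (pderiv p) z) \<le> e" if "z \<in> cball 0 1" for z
      using d[OF that] by (simp add: p(1) less_imp_le)
    fix z :: complex assume z: "z \<in> cball 0 1"
    have "norm ((h z - poly p z) - (h 0 - poly p 0)) \<le> e * norm (z - 0)"
    proof (rule field_differentiable_bound[of "cball 0 1"])
      fix u :: complex assume u: "u \<in> cball 0 1"
      then have "u \<in> ball 0 R" using R by auto
      then have "(h has_field_derivative deriv h u) (at u)"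
        using h holomorphic_derivI[OF h open_ball] by auto
      then show "((\<lambda>z. h z - poly p z) has_field_derivative deriv h u - poly (pderiv p) u)
          (at u within cball 0 1)"
        by (rule has_field_derivative_at_within[OF DERIV_diff[OF _ poly_DERIV]])
    qed (use D z in auto)
    also have "e * norm (z - 0) \<le> e" using z e by (simp add: mult_left_le)
    finally show "cmod (h z - poly p z) \<le> e" by (simp add: p(2))
  qed
qed

lemma zbar_comb_poly_approx:
  assumes h: "\<And>j. h j holomorphic_on ball 0 R" and R: "1 < R" and e: "0 < e"
  obtains p where "zbar_poly n p 0 = zbar_comb n h 0"
    "\<And>z. z \<in> ball 0 1 \<Longrightarrow> cmod (d_z (zbar_comb n h) z - d_z (zbar_poly n p) z) \<le> e"
    "\<And>z. z \<in> ball 0 1 \<Longrightarrow> cmod (d_zbar (zbar_comb n h) z - d_zbar (zbar_poly n p) z) \<le> e"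
proof -
  \<comment> \<open>Each derivative is a sum of \<open>n\<close> terms whose factors other than the coefficient error have
    modulus at most \<open>n\<close>.\<close>
  define d where "d = e / (real n * real n + 1)"
  have pos: "0 < real n * real n + 1" by (intro add_nonneg_pos) auto
  then have d: "d > 0" using e by (simp add: d_def)
  have "real n * real n * d \<le> (real n * real n + 1) * d" using d by simp
  also have "\<dots> = e" unfolding d_def using pos by simp
  finally have nnd: "real n * real n * d \<le> e" .
  have "\<exists>p. poly p 0 = h j 0 \<and> (\<forall>z\<in>cball 0 1. cmod (h j z - poly p z) \<le> d \<and>
      cmod (deriv (h j) z - poly (pderiv p) z) \<le> d)" for j
    using holomorphic_C1_poly_approx[OF h R d, of j] by metis
  then obtain p where p: "\<And>j. poly (p j) 0 = h j 0"
    "\<And>j z. z \<in> cball 0 1 \<Longrightarrow> cmod (h j z - poly (p j) z) \<le> d"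
    "\<And>j z. z \<in> cball 0 1 \<Longrightarrow> cmod (deriv (h j) z - poly (pderiv (p j)) z) \<le> d"
    by metis
  have bound: "cmod (\<Sum>j<n. c j * x j) \<le> e"
    if "\<And>j. j < n \<Longrightarrow> cmod (c j) \<le> n" "\<And>j. cmod (x j) \<le> d" for c x
  proof -
    have "cmod (\<Sum>j<n. c j * x j) \<le> (\<Sum>j<n. n * d)"
      by (rule sum_norm_le) (auto simp: norm_mult intro!: mult_mono that)
    then show ?thesis using nnd by simp
  qed
  show ?thesis
  proof
    show "zbar_poly n p 0 = zbar_comb n h 0" by (simp add: zbar_comb_def p(1))
    fix z :: complex assume z: "z \<in> ball 0 1"
    then have z1: "z \<in> cball 0 1" and zR: "z \<in> ball 0 R" using R by auto
    have zj: "cmod z ^ j \<le> 1" for j using z1 by (simp add: power_le_one)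
    have hp: "poly (p j) holomorphic_on ball 0 R" for j
      by (intro holomorphic_intros)
    have dp: "deriv (poly (p j)) z = poly (pderiv (p j)) z" for j
      by (intro DERIV_imp_deriv poly_DERIV)
    note Dh = wirtinger_zbar_comb[OF h open_ball zR, of n]
    note Dp = wirtinger_zbar_comb[OF hp open_ball zR, of n]
    have "d_z (zbar_comb n h) z - d_z (zbar_poly n p) z =
      (\<Sum>j<n. cnj z ^ j * (deriv (h j) z - poly (pderiv (p j)) z))"
      unfolding Dh Dp by (simp add: zbar_comb_def dp algebra_simps sum_subtractf)
    also have "cmod \<dots> \<le> e"
    proof (rule bound)
      fix j assume "j < n"
      then have "1 \<le> real n" by linarith
      then show "cmod (cnj z ^ j) \<le> n" using zj[of j] by (simp add: norm_power)
    qed (use p z1 in auto)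
    finally show "cmod (d_z (zbar_comb n h) z - d_z (zbar_poly n p) z) \<le> e" .
    have "d_zbar (zbar_comb n h) z - d_zbar (zbar_poly n p) z =
      (\<Sum>j<n. (of_nat j * cnj z ^ (j - 1)) * (h j z - poly (p j) z))"
      unfolding Dh Dp by (simp add: algebra_simps sum_subtractf)
    also have "cmod \<dots> \<le> e"
    proof (rule bound)
      fix j assume "j < n"
      then have "real j * cmod z ^ (j - 1) \<le> real n * 1"
        using zj[of "j - 1"] by (intro mult_mono) auto
      then show "cmod (of_nat j * cnj z ^ (j - 1)) \<le> n" by (simp add: norm_power norm_mult)
    qed (use p z1 in auto)
    finally show "cmod (d_zbar (zbar_comb n h) z - d_zbar (zbar_poly n p) z) \<le> e" .
  qed
qed

section \<open>Dilations in weighted means\<close>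

lemma powr_add_le_two_powr:
  fixes x y p :: real
  assumes "0 \<le> x" "0 \<le> y" "0 \<le> p"
  shows "(x + y) powr p \<le> 2 powr p * (x powr p + y powr p)"
proof -
  have "(x + y) powr p \<le> (2 * max x y) powr p"
    using assms by (intro powr_mono2) auto
  also have "\<dots> = 2 powr p * max x y powr p"
    using assms by (simp add: powr_mult)
  also have "\<dots> \<le> 2 powr p * (x powr p + y powr p)"
    by (intro mult_left_mono) (auto simp: max_def)
  finally show ?thesis .
qed

lemma nn_integral_lebesgue_complex_scale:
  fixes F :: "complex \<Rightarrow> ennreal"
  assumes F: "F \<in> borel_measurable lebesgue" and c: "0 < c"
  shows "(\<integral>\<^sup>+z. F z \<partial>lebesgue) = ennreal (c\<^sup>2) * (\<integral>\<^sup>+z. F (of_real c * z) \<partial>lebesgue)"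
proof -
  have eq: "lebesgue = density (distr lebesgue lebesgue (\<lambda>z::complex. c *\<^sub>R z)) (\<lambda>_. ennreal (c\<^sup>2))"
  proof -
    have "(0::complex) + (\<Sum>j\<in>Basis. (c * (z \<bullet> j)) *\<^sub>R j) = c *\<^sub>R z" for z
      by (simp add: Basis_complex_def complex_eq_iff)
    then show ?thesis
      using lebesgue_affine_euclidean[of "\<lambda>_. c" "0::complex"] c
      by (simp only: prod_constant DIM_complex) (simp add: power2_eq_square ennreal_mult)
  qed
  have m: "(\<lambda>z::complex. c *\<^sub>R z) \<in> lebesgue \<rightarrow>\<^sub>M lebesgue"
    by (rule lebesgue_measurable_scaling)
  have "(\<integral>\<^sup>+z. F z \<partial>lebesgue) =
      (\<integral>\<^sup>+z. F z \<partial>density (distr lebesgue lebesgue (\<lambda>z::complex. c *\<^sub>R z)) (\<lambda>_. ennreal (c\<^sup>2)))"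
    by (subst eq[symmetric]) (rule refl)
  also have "\<dots> = (\<integral>\<^sup>+z. ennreal (c\<^sup>2) * F (c *\<^sub>R z) \<partial>lebesgue)"
    using F m by (simp add: nn_integral_density nn_integral_distr)
  also have "\<dots> = ennreal (c\<^sup>2) * (\<integral>\<^sup>+z. F (c *\<^sub>R z) \<partial>lebesgue)"
    using measurable_compose[OF m F] by (intro nn_integral_cmult) simp
  finally show ?thesis by (simp add: scaleR_conv_of_real)
qed

text \<open>
  The map \<open>(r, z) \<mapsto> r * g (r z)\<close> is uniformly continuous on the compact set
  \<open>{0..1} \<times> cball 0 \<rho>\<close>.
\<close>

lemma eventually_dilation_close:
  fixes g :: "complex \<Rightarrow> complex"
  assumes g: "continuous_on (ball 0 1) g" and \<rho>: "\<rho> < 1" and d: "0 < d"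
  shows "\<forall>\<^sub>F r in at_left 1. \<forall>z\<in>cball 0 \<rho>. cmod (g z - of_real r * g (of_real r * z)) \<le> d"
proof -
  let ?S = "{0..1} \<times> cball 0 \<rho> :: (real \<times> complex) set"
  define F where "F = (\<lambda>(r, z). complex_of_real r * g (of_real r * z))"
  have "continuous_on ?S F"
  proof -
    have "continuous_on ?S (\<lambda>x. g (of_real (fst x) * snd x))"
    proof (rule continuous_on_compose2[OF g])
      show "(\<lambda>x. of_real (fst x) * snd x) ` ?S \<subseteq> ball 0 1"
      proof clarsimp
        fix r :: real and z :: complex assume "0 \<le> r" "r \<le> 1" "cmod z \<le> \<rho>"
        then have "r * cmod z \<le> 1 * \<rho>" by (intro mult_mono) auto
        then show "cmod (of_real r * z) < 1" using \<rho> \<open>0 \<le> r\<close> by (simp add: norm_mult)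
      qed
    qed (intro continuous_intros)
    then show ?thesis unfolding F_def case_prod_beta by (intro continuous_intros)
  qed
  then have "uniformly_continuous_on ?S F"
    by (rule compact_uniformly_continuous) (intro compact_Times compact_cball compact_Icc)
  then obtain \<delta> where \<delta>: "\<delta> > 0" "\<And>x y. x \<in> ?S \<Longrightarrow> y \<in> ?S \<Longrightarrow> dist y x < \<delta> \<Longrightarrow> dist (F y) (F x) < d"
    using d unfolding uniformly_continuous_on_def by metis
  have "\<forall>\<^sub>F r in at_left 1. r \<in> {max 0 (1 - \<delta>)<..<1}"
    by (rule eventually_at_leftI[of "max 0 (1 - \<delta>)"]) (use \<delta> in auto)
  then show ?thesis
  proof eventually_elim
    case (elim r)
    show ?case
    proof
      fix z :: complex assume z: "z \<in> cball 0 \<rho>"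
      have "dist (1, z) (r, z) < \<delta>" using elim by (auto simp: dist_Pair_Pair dist_real_def)
      then have "dist (F (1, z)) (F (r, z)) < d" using elim z by (intro \<delta>(2)) auto
      then show "cmod (g z - of_real r * g (of_real r * z)) \<le> d" by (simp add: F_def dist_norm)
    qed
  qed
qed

text \<open>
  The inequality that the theorem imposes on \<open>w\<close>, for the full density of the seminorm and with
  a constant that does not depend on \<open>r\<close>. The density is extended by zero, so that no condition
  on \<open>z\<close> is left.
\<close>

locale dilation_weight =
  fixes W :: "complex \<Rightarrow> real" and K r0 :: real
  assumes integrable: "integrable lebesgue W"
    and nonneg: "0 \<le> W z"
    and outside: "z \<notin> ball 0 1 \<Longrightarrow> W z = 0"
    and K: "0 \<le> K" and r0: "0 < r0" "r0 < 1"
    and dilation: "r0 \<le> r \<Longrightarrow> r < 1 \<Longrightarrow> W (z / of_real r) \<le> K * W z"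
begin

lemma measurable_W [measurable]: "W \<in> borel_measurable lebesgue"
  using integrable by (rule borel_measurable_integrable)

text \<open>
  Substituting \<open>u = r z\<close> moves the dilation from \<open>\<phi>\<close> to the density, where it costs only a
  constant factor. This is the one place where the dilation inequality is used.
\<close>

lemma nn_integral_dilate_le:
  assumes \<phi>: "\<phi> \<in> borel_measurable borel" and r: "r0 \<le> r" "r < 1"
  shows "(\<integral>\<^sup>+z. \<phi> (of_real r * z) * ennreal (W z) \<partial>lebesgue)
    \<le> ennreal (K / r0\<^sup>2) * (\<integral>\<^sup>+z. \<phi> z * ennreal (W z) \<partial>lebesgue)"
proof -
  have r': "0 < r" using r r0 by simp
  have m1: "\<phi> \<in> borel_measurable lebesgue"
    using \<phi> by (simp add: measurable_completion)
  have "(\<lambda>z. \<phi> (of_real r * z)) \<in> borel_measurable borel"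
    by (rule measurable_compose[OF _ \<phi>]) simp
  then have m2: "(\<lambda>z. \<phi> (of_real r * z)) \<in> borel_measurable lebesgue"
    by (simp add: measurable_completion)
  have "(\<integral>\<^sup>+z. \<phi> (of_real r * z) * ennreal (W z) \<partial>lebesgue) =
      ennreal ((1/r)\<^sup>2) * (\<integral>\<^sup>+z. \<phi> (of_real r * (of_real (1/r) * z)) * ennreal (W (of_real (1/r) * z)) \<partial>lebesgue)"
    using m2 r' by (intro nn_integral_lebesgue_complex_scale) auto
  also have "\<dots> \<le> ennreal ((1/r0)\<^sup>2) * (\<integral>\<^sup>+z. ennreal K * (\<phi> z * ennreal (W z)) \<partial>lebesgue)"
  proof (rule mult_mono[OF _ nn_integral_mono])
    show "ennreal ((1/r)\<^sup>2) \<le> ennreal ((1/r0)\<^sup>2)"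
      using r r' r0 by (intro ennreal_leI power_mono frac_le) auto
    fix z
    have "ennreal (W (of_real (1/r) * z)) \<le> ennreal (K * W z)"
      using dilation[OF r, of z] by (intro ennreal_leI) simp
    also have "\<dots> = ennreal K * ennreal (W z)" using K nonneg by (simp add: ennreal_mult)
    finally have "\<phi> z * ennreal (W (of_real (1/r) * z)) \<le> \<phi> z * (ennreal K * ennreal (W z))"
      by (rule mult_left_mono) simp
    then show "\<phi> (of_real r * (of_real (1/r) * z)) * ennreal (W (of_real (1/r) * z))
        \<le> ennreal K * (\<phi> z * ennreal (W z))"
      using r' by (simp add: mult_ac)
  qed auto
  also have "\<dots> = ennreal ((1/r0)\<^sup>2) * (ennreal K * (\<integral>\<^sup>+z. \<phi> z * ennreal (W z) \<partial>lebesgue))"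
    using m1 by (simp add: nn_integral_cmult)
  also have "\<dots> = ennreal (K / r0\<^sup>2) * (\<integral>\<^sup>+z. \<phi> z * ennreal (W z) \<partial>lebesgue)"
  proof -
    have "ennreal ((1/r0)\<^sup>2) * ennreal K = ennreal (K / r0\<^sup>2)"
      using K by (simp add: ennreal_mult[symmetric] power_divide)
    then show ?thesis by (simp add: mult.assoc[symmetric])
  qed
  finally show ?thesis .
qed

lemma tail_small:
  assumes \<phi>: "\<phi> \<in> borel_measurable borel"
    and fin: "(\<integral>\<^sup>+z. \<phi> z * ennreal (W z) \<partial>lebesgue) < \<infinity>" and e: "0 < e"
  obtains \<rho> where "0 < \<rho>" "\<rho> < 1"
    "(\<integral>\<^sup>+z. (\<phi> z * indicator {z. \<rho> \<le> cmod z} z) * ennreal (W z) \<partial>lebesgue) < e"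
proof -
  have [measurable]: "\<phi> \<in> borel_measurable lebesgue"
    using \<phi> by (simp add: measurable_completion)
  have [measurable]: "{z::complex. a \<le> cmod z} \<in> sets lebesgue" for a
    by simp
  define \<rho> where "\<rho> n = 1 - inverse (real (Suc (Suc n)))" for n
  have "\<rho> \<longlonglongrightarrow> 1 - 0"
    unfolding \<rho>_def
    by (intro tendsto_diff tendsto_const LIMSEQ_Suc[OF LIMSEQ_inverse_real_of_nat])
  then have \<rho>_lim: "\<rho> \<longlonglongrightarrow> 1" by simp
  have "(\<lambda>n. \<integral>\<^sup>+z. (\<phi> z * indicator {z. \<rho> n \<le> cmod z} z) * ennreal (W z) \<partial>lebesgue)
      \<longlonglongrightarrow> (integral\<^sup>N lebesgue (\<lambda>z::complex. 0))"
  proof (rule nn_integral_dominated_convergence[where w = "\<lambda>z. \<phi> z * ennreal (W z)"])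
    show "AE z in lebesgue. (\<lambda>n. (\<phi> z * indicator {z. \<rho> n \<le> cmod z} z) * ennreal (W z)) \<longlonglongrightarrow> 0"
    proof (intro AE_I2)
      fix z :: complex
      show "(\<lambda>n. (\<phi> z * indicator {z. \<rho> n \<le> cmod z} z) * ennreal (W z)) \<longlonglongrightarrow> 0"
      proof (cases "z \<in> ball 0 1")
        case True
        then have "\<forall>\<^sub>F n in sequentially. cmod z < \<rho> n"
          using \<rho>_lim by (intro order_tendstoD) auto
        then have "\<forall>\<^sub>F n in sequentially. (\<phi> z * indicator {z. \<rho> n \<le> cmod z} z) * ennreal (W z) = 0"
          by eventually_elim auto
        then show ?thesis by (rule tendsto_eventually)
      qed (simp add: outside)
    qed
    show "AE z in lebesgue. (\<phi> z * indicator {z. \<rho> n \<le> cmod z} z) * ennreal (W z) \<le> \<phi> z * ennreal (W z)" for n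
      by (intro AE_I2) (simp add: indicator_def)
  qed (use fin in auto)
  then have "\<forall>\<^sub>F n in sequentially.
      (\<integral>\<^sup>+z. (\<phi> z * indicator {z. \<rho> n \<le> cmod z} z) * ennreal (W z) \<partial>lebesgue) < e"
    using e by (intro order_tendstoD) auto
  then obtain n where n: "(\<integral>\<^sup>+z. (\<phi> z * indicator {z. \<rho> n \<le> cmod z} z) * ennreal (W z) \<partial>lebesgue) < e"
    by (auto simp: eventually_sequentially)
  show ?thesis
  proof (rule that[OF _ _ n])
    show "0 < \<rho> n" "\<rho> n < 1" by (auto simp: \<rho>_def field_simps)
  qed
qed

text \<open>
  The density is merely measurable, so after the substitution there is no pointwise convergence
  of the dilated densities to rely on. Instead the disc is cut near its boundary. In the inner part
  \<open>r * g (r z)\<close> tends to \<open>g\<close> uniformly and the density has finite mass. In the outer part both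
  \<open>g\<close> and its dilations contribute little: the mass of \<open>\<bar>g\<bar>\<^sup>p\<close> near the boundary is small, and
  \<open>nn_integral_dilate_le\<close> bounds that of the dilations by it, uniformly in \<open>r\<close>.
\<close>

lemma dilation_Lp_convergence:
  assumes g: "continuous_on (ball 0 1) g" and p: "0 < p" and e: "0 < e"
    and fin: "(\<integral>\<^sup>+z. ennreal (cmod (g z) powr p) * ennreal (W z) \<partial>lebesgue) < \<infinity>"
  shows "\<forall>\<^sub>F r in at_left 1.
    (\<integral>\<^sup>+z. ennreal (cmod (g z - of_real r * g (of_real r * z)) powr p) * ennreal (W z) \<partial>lebesgue)
      < ennreal e"
proof -
  define M where "M = integral\<^sup>L lebesgue W"
  have M: "0 \<le> M" "(\<integral>\<^sup>+z. ennreal (W z) \<partial>lebesgue) = ennreal M"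
    using integrable nonneg by (auto simp: M_def nn_integral_eq_integral)
  define \<delta> where "\<delta> = (e / (2 * (M + 1))) powr (1 / p)"
  have \<delta>: "0 < \<delta>" "\<delta> powr p = e / (2 * (M + 1))"
    using e p M by (auto simp: \<delta>_def powr_powr)
  define L where "L = 2 powr p * (1 + K / r0\<^sup>2)"
  have L: "0 < L" using K r0 by (auto simp: L_def intro!: mult_pos_pos add_pos_nonneg)
  define \<phi>0 where "\<phi>0 z = ennreal (cmod (if z \<in> ball 0 1 then g z else 0) powr p)" for z
  have "(\<lambda>z. if z \<in> ball 0 1 then g z else 0) \<in> borel_measurable borel"
    by (rule borel_measurable_continuous_on_if) (use g in auto)
  then have [measurable]: "\<phi>0 \<in> borel_measurable borel"
    unfolding \<phi>0_def by measurable
  have "(\<integral>\<^sup>+z. \<phi>0 z * ennreal (W z) \<partial>lebesgue) =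
      (\<integral>\<^sup>+z. ennreal (cmod (g z) powr p) * ennreal (W z) \<partial>lebesgue)"
    by (intro nn_integral_cong) (auto simp: \<phi>0_def outside)
  then have fin0: "(\<integral>\<^sup>+z. \<phi>0 z * ennreal (W z) \<partial>lebesgue) < \<infinity>" using fin by simp
  obtain \<rho> where \<rho>: "0 < \<rho>" "\<rho> < 1"
    "(\<integral>\<^sup>+z. (\<phi>0 z * indicator {z. \<rho> \<le> cmod z} z) * ennreal (W z) \<partial>lebesgue) < ennreal (e / (2 * L))"
    by (rule tail_small[OF _ fin0, of "ennreal (e / (2 * L))"]) (use e L in auto)
  \<comment> \<open>The inner part is cut at \<open>sqrt \<rho>\<close>: for \<open>r \<ge> sqrt \<rho>\<close> and \<open>\<bar>z\<bar> \<ge> sqrt \<rho>\<close> the dilated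
    point \<open>r z\<close> still satisfies \<open>\<bar>r z\<bar> \<ge> \<rho>\<close>, so \<open>\<phi>\<close> dominates the outer part at \<open>z\<close> and at
    \<open>r z\<close>.\<close>
  define \<phi> where "\<phi> z = \<phi>0 z * indicator {z. \<rho> \<le> cmod z} z" for z
  define T where "T = (\<integral>\<^sup>+z. \<phi> z * ennreal (W z) \<partial>lebesgue)"
  have T: "T < ennreal (e / (2 * L))" using \<rho>(3) by (simp add: T_def \<phi>_def)
  then obtain t where t: "T = ennreal t" "0 \<le> t" "t < e / (2 * L)"
    by (cases T) (auto simp: ennreal_less_iff)
  have \<phi>_meas: "\<phi> \<in> borel_measurable borel"
    unfolding \<phi>_def by measurable
  then have [measurable]: "\<phi> \<in> borel_measurable lebesgue"
    by (simp add: measurable_completion)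
  have "(\<lambda>z. \<phi> (of_real r * z)) \<in> borel_measurable borel" for r
    by (rule measurable_compose[OF _ \<phi>_meas]) simp
  then have [measurable]: "(\<lambda>z. \<phi> (of_real r * z)) \<in> borel_measurable lebesgue" for r
    by (simp add: measurable_completion)
  have "sqrt \<rho> < 1" using \<rho> by simp
  have "\<forall>\<^sub>F r in at_left 1. r \<in> {max (sqrt \<rho>) r0<..<1}"
    by (rule eventually_at_leftI[of "max (sqrt \<rho>) r0"]) (use \<rho> r0 in auto)
  then show ?thesis
    using eventually_dilation_close[OF g \<open>sqrt \<rho> < 1\<close> \<delta>(1)]
  proof eventually_elim
    case (elim r)
    then have r: "r0 \<le> r" "r < 1" "sqrt \<rho> \<le> r" "0 < r" using r0 by auto
    have pw: "ennreal (cmod (g z - of_real r * g (of_real r * z)) powr p) * ennreal (W z) \<le>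
      ennreal (\<delta> powr p) * ennreal (W z) + (ennreal (2 powr p) * (\<phi> z * ennreal (W z)) +
        ennreal (2 powr p) * (\<phi> (of_real r * z) * ennreal (W z)))" (is "?lhs \<le> ?rhs") for z
    proof (cases "z \<in> ball 0 1")
      case z: True
      show ?thesis
      proof (cases "cmod z \<le> sqrt \<rho>")
        case True
        then have "cmod (g z - of_real r * g (of_real r * z)) powr p \<le> \<delta> powr p"
          using elim(2) p by (intro powr_mono2) auto
        then have "?lhs \<le> ennreal (\<delta> powr p) * ennreal (W z)"
          by (intro mult_right_mono ennreal_leI) auto
        then show ?thesis by (rule order_trans) simp
      next
        case False
        have rz: "cmod (of_real r * z) = r * cmod z" using r by (simp add: norm_mult)
        have "sqrt \<rho> * sqrt \<rho> \<le> r * cmod z"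
          using False r \<rho> by (intro mult_mono) auto
        then have "\<rho> \<le> r * cmod z" using \<rho> by simp
        moreover have "r * cmod z \<le> 1 * cmod z" using r by (intro mult_right_mono) auto
        ultimately have \<phi>z: "\<phi> z = ennreal (cmod (g z) powr p)"
          "\<phi> (of_real r * z) = ennreal (cmod (g (of_real r * z)) powr p)"
          using z rz by (auto simp: \<phi>_def \<phi>0_def)
        have "cmod (g z - of_real r * g (of_real r * z)) \<le> cmod (g z) + cmod (of_real r * g (of_real r * z))"
          by (rule norm_triangle_ineq4)
        also have "cmod (of_real r * g (of_real r * z)) \<le> 1 * cmod (g (of_real r * z))"
          unfolding norm_mult using r by (intro mult_right_mono) auto
        finally have "cmod (g z - of_real r * g (of_real r * z)) powr p \<le>
            (cmod (g z) + cmod (g (of_real r * z))) powr p"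
          using p by (intro powr_mono2) auto
        also have "\<dots> \<le> 2 powr p * (cmod (g z) powr p + cmod (g (of_real r * z)) powr p)"
          using p by (intro powr_add_le_two_powr) auto
        finally have "ennreal (cmod (g z - of_real r * g (of_real r * z)) powr p) \<le>
            ennreal (2 powr p) * (\<phi> z + \<phi> (of_real r * z))"
          unfolding \<phi>z by (simp add: ennreal_leI flip: ennreal_mult ennreal_plus)
        then have "?lhs \<le> ennreal (2 powr p) * (\<phi> z + \<phi> (of_real r * z)) * ennreal (W z)"
          by (rule mult_right_mono) simp
        also have "\<dots> = ennreal (2 powr p) * (\<phi> z * ennreal (W z)) +
            ennreal (2 powr p) * (\<phi> (of_real r * z) * ennreal (W z))"
          by (simp add: algebra_simps)
        finally show ?thesis by (rule order_trans) simp
      qed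
    qed (simp add: outside)
    have "(\<integral>\<^sup>+z. ennreal (cmod (g z - of_real r * g (of_real r * z)) powr p) * ennreal (W z) \<partial>lebesgue)
      \<le> (\<integral>\<^sup>+z. ennreal (\<delta> powr p) * ennreal (W z) + (ennreal (2 powr p) * (\<phi> z * ennreal (W z)) +
        ennreal (2 powr p) * (\<phi> (of_real r * z) * ennreal (W z))) \<partial>lebesgue)"
      by (intro nn_integral_mono pw)
    also have "\<dots> = ennreal (\<delta> powr p) * ennreal M + (ennreal (2 powr p) * T +
        ennreal (2 powr p) * (\<integral>\<^sup>+z. \<phi> (of_real r * z) * ennreal (W z) \<partial>lebesgue))"
      by (simp add: nn_integral_add nn_integral_cmult M T_def)
    also have "\<dots> \<le> ennreal (\<delta> powr p) * ennreal M + (ennreal (2 powr p) * T +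
        ennreal (2 powr p) * (ennreal (K / r0\<^sup>2) * T))"
      unfolding T_def by (intro add_left_mono mult_left_mono nn_integral_dilate_le \<phi>_meas r) auto
    also have "\<dots> = ennreal (\<delta> powr p * M) + ennreal L * T"
    proof -
      have "ennreal L = ennreal (2 powr p) + ennreal (2 powr p) * ennreal (K / r0\<^sup>2)"
        using K by (simp add: L_def algebra_simps flip: ennreal_mult ennreal_plus)
      then show ?thesis using M(1) by (simp add: ennreal_mult algebra_simps)
    qed
    also have "\<dots> = ennreal (\<delta> powr p * M + L * t)"
      using t L M(1) by (simp add: ennreal_mult)
    also have "\<dots> < ennreal e"
    proof (rule ennreal_lessI[OF e])
      have "\<delta> powr p * M \<le> e / (2 * (M + 1)) * (M + 1)"
        unfolding \<delta>(2) using M(1) e by (intro mult_left_mono) auto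
      also have "\<dots> = e / 2" using M(1) by (simp add: field_simps)
      finally have "\<delta> powr p * M \<le> e / 2" .
      moreover have "L * t < e / 2" using t(3) L by (simp add: field_simps)
      ultimately show "\<delta> powr p * M + L * t < e" by simp
    qed
    finally show ?case .
  qed
qed

end

section \<open>The Besov norm and density of polynomials\<close>

definition besov_density :: "real \<Rightarrow> (complex \<Rightarrow> real) \<Rightarrow> complex \<Rightarrow> real" where
  "besov_density p w z = indicator (ball 0 1) z * ((1 - (cmod z)\<^sup>2) powr (p - 2) * w z)"

lemma besov_integral_eq:
  "besov_integral p w f =
    (\<integral>\<^sup>+z. ennreal (cmod (d_z f z) powr p + cmod (d_zbar f z) powr p) * ennreal (besov_density p w z) \<partial>lebesgue)"
  unfolding besov_integral_def
proof (rule nn_integral_cong)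
  fix z :: complex
  show "ennreal ((1 - (cmod z)\<^sup>2) powr (p - 2) *
        (cmod (d_z f z) powr p + cmod (d_zbar f z) powr p) * w z) * indicator (ball 0 1) z =
     ennreal (cmod (d_z f z) powr p + cmod (d_zbar f z) powr p) * ennreal (besov_density p w z)"
    by (subst ennreal_mult'[symmetric]) (auto simp: besov_density_def indicator_def mult_ac)
qed

text \<open>
  Here \<open>p \<ge> 2\<close> enters: it makes \<open>(1 - \<bar>z\<bar>\<^sup>2) powr (p - 2)\<close> bounded by \<open>1\<close>, so that the density
  inherits integrability from \<open>w\<close>, and nonincreasing in \<open>\<bar>z\<bar>\<close>, so that passing from \<open>z\<close> to
  \<open>z / r\<close> does not increase it.
\<close>

lemma dilation_weight_besov_density:
  assumes p: "2 \<le> p" and w: "weight w" and C: "C > 0" and r0: "0 < r0" "r0 < 1"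
    and dil: "\<And>r z. r0 \<le> r \<Longrightarrow> r < 1 \<Longrightarrow> cmod z < r \<Longrightarrow>
           r ^ k * w (z / complex_of_real r) \<le> C * w z"
  shows "dilation_weight (besov_density p w) (C / r0 ^ k) r0"
proof
  have pos: "0 < w z" if "z \<in> ball 0 1" for z using w that by (auto simp: weight_def)
  have int: "integrable lebesgue (\<lambda>z. indicator (ball 0 1) z *\<^sub>R w z)"
    using w by (auto simp: weight_def set_integrable_def)
  have bd: "0 \<le> (1 - (cmod z)\<^sup>2) powr (p - 2)" "(1 - (cmod z)\<^sup>2) powr (p - 2) \<le> 1"
    if "z \<in> ball 0 1" for z
  proof -
    have "0 \<le> 1 - (cmod z)\<^sup>2" using that by (simp add: power_le_one)
    then show "(1 - (cmod z)\<^sup>2) powr (p - 2) \<le> 1" using p by (intro powr_le1) auto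
  qed simp
  show "integrable lebesgue (besov_density p w)"
  proof (rule Bochner_Integration.integrable_bound[OF int])
    have "(\<lambda>z::complex. (1 - (cmod z)\<^sup>2) powr (p - 2)) \<in> borel_measurable borel"
      by measurable
    then have "(\<lambda>z::complex. (1 - (cmod z)\<^sup>2) powr (p - 2)) \<in> borel_measurable lebesgue"
      by (simp add: measurable_completion)
    then have "(\<lambda>z. (1 - (cmod z)\<^sup>2) powr (p - 2) * (indicator (ball 0 1) z *\<^sub>R w z))
        \<in> borel_measurable lebesgue"
      by (rule borel_measurable_times) (rule borel_measurable_integrable[OF int])
    moreover have "(\<lambda>z. (1 - (cmod z)\<^sup>2) powr (p - 2) * (indicator (ball 0 1) z *\<^sub>R w z)) =
        besov_density p w"
      by (auto simp: besov_density_def fun_eq_iff)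
    ultimately show "besov_density p w \<in> borel_measurable lebesgue" by simp
    show "AE z in lebesgue. norm (besov_density p w z) \<le> norm (indicator (ball 0 1) z *\<^sub>R w z)"
    proof (rule AE_I2)
      fix z :: complex
      show "norm (besov_density p w z) \<le> norm (indicator (ball 0 1) z *\<^sub>R w z)"
      proof (cases "z \<in> ball 0 1")
        case True
        then show ?thesis using bd[OF True] pos[OF True]
          by (simp add: besov_density_def abs_mult mult_left_le_one_le)
      qed (simp add: besov_density_def)
    qed
  qed
  show nn: "0 \<le> besov_density p w z" for z
    using pos[of z] by (simp add: besov_density_def indicator_def less_imp_le)
  show "besov_density p w z = 0" if "z \<notin> ball 0 1" for z
    using that by (simp add: besov_density_def)
  show K: "0 \<le> C / r0 ^ k" using C r0 by simp
  show "0 < r0" "r0 < 1" by fact+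
  fix r z assume r: "r0 \<le> r" "r < 1"
  have r': "0 < r" using r r0 by simp
  show "besov_density p w (z / of_real r) \<le> C / r0 ^ k * besov_density p w z"
  proof (cases "cmod z < r")
    case False
    then have "z / of_real r \<notin> ball 0 1" using r' by (simp add: norm_divide field_simps)
    then have "besov_density p w (z / of_real r) = 0" by (simp add: besov_density_def)
    then show ?thesis using mult_nonneg_nonneg[OF K nn] by simp
  next
    case True
    then have z: "z \<in> ball 0 1" "z / of_real r \<in> ball 0 1"
      using r r' by (auto simp: norm_divide field_simps)
    have "r0 ^ k * w (z / of_real r) \<le> r ^ k * w (z / of_real r)"
      using r r0 pos[OF z(2)] by (intro mult_right_mono power_mono) auto
    also have "\<dots> \<le> C * w z" by (rule dil) fact+
    finally have w_le: "w (z / of_real r) \<le> C / r0 ^ k * w z"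
      using r0 by (simp add: field_simps)
    have "cmod z \<le> cmod (z / of_real r)"
      using r r' by (simp add: norm_divide field_simps mult_left_le_one_le)
    then have "(cmod z)\<^sup>2 \<le> (cmod (z / of_real r))\<^sup>2" by (rule power_mono) simp
    moreover have "(cmod (z / of_real r))\<^sup>2 \<le> 1" using z(2) by (simp add: power_le_one)
    ultimately have "(1 - (cmod (z / of_real r))\<^sup>2) powr (p - 2) \<le> (1 - (cmod z)\<^sup>2) powr (p - 2)"
      using p by (intro powr_mono2) auto
    then have "(1 - (cmod (z / of_real r))\<^sup>2) powr (p - 2) * w (z / of_real r) \<le>
        (1 - (cmod z)\<^sup>2) powr (p - 2) * (C / r0 ^ k * w z)"
      using w_le pos[OF z(2)] by (intro mult_mono) auto
    then show ?thesis using z by (simp add: besov_density_def mult_ac)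
  qed
qed

lemma besov_norm_finite_iff: "besov_norm p w f < top \<longleftrightarrow> besov_integral p w f < top"
  by (auto simp: besov_norm_def top.not_eq_extremum)

lemma besov_norm_less:
  assumes p: "0 < p" and e: "0 < e" and f0: "f 0 = 0" and s: "0 \<le> s" "s < e powr p"
    and le: "besov_integral p w f \<le> ennreal s"
  shows "besov_norm p w f < ennreal e"
proof -
  have "besov_integral p w f < \<infinity>" using le by (rule le_less_trans) simp
  then have "besov_norm p w f = ennreal (enn2real (besov_integral p w f) powr (1 / p))"
    using f0 by (simp add: besov_norm_def)
  also have "\<dots> \<le> ennreal (s powr (1 / p))"
  proof (intro ennreal_leI powr_mono2)
    show "enn2real (besov_integral p w f) \<le> s" using enn2real_mono[OF le] s by simp
  qed (use p in auto)
  also have "\<dots> < ennreal e"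
  proof (rule ennreal_lessI[OF e])
    have "s powr (1 / p) < (e powr p) powr (1 / p)"
      using s p by (intro powr_less_mono2) auto
    then show "s powr (1 / p) < e" using p e by (simp add: powr_powr)
  qed
  finally show ?thesis .
qed

lemma zbar_poly_in_besov_space:
  assumes "dilation_weight (besov_density p w) K r0" and p: "0 < p"
  shows "zbar_poly q P \<in> besov_space q p w"
proof -
  interpret dilation_weight "besov_density p w" K r0 by fact
  have "\<exists>B. \<forall>z\<in>cball 0 1. cmod (zbar_poly n Q z) \<le> B" for n Q
  proof -
    have "bounded (zbar_poly n Q ` cball 0 1)"
      by (intro compact_imp_bounded compact_continuous_image continuous_on_zbar_poly compact_cball)
    then show ?thesis by (auto simp: bounded_iff)
  qed
  then obtain A B where AB: "\<And>z. z \<in> cball 0 1 \<Longrightarrow> cmod (d_z (zbar_poly q P) z) \<le> A"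
    "\<And>z. z \<in> cball 0 1 \<Longrightarrow> cmod (d_zbar (zbar_poly q P) z) \<le> B"
    unfolding wirtinger_zbar_poly by metis
  have "besov_integral p w (zbar_poly q P) \<le>
     (\<integral>\<^sup>+z. ennreal (A powr p + B powr p) * ennreal (besov_density p w z) \<partial>lebesgue)"
    unfolding besov_integral_eq
  proof (rule nn_integral_mono)
    fix z :: complex
    show "ennreal (cmod (d_z (zbar_poly q P) z) powr p + cmod (d_zbar (zbar_poly q P) z) powr p) *
        ennreal (besov_density p w z) \<le>
        ennreal (A powr p + B powr p) * ennreal (besov_density p w z)"
    proof (cases "z \<in> ball 0 1")
      case True
      then show ?thesis
        using AB[of z] p by (intro mult_right_mono ennreal_leI add_mono powr_mono2) auto
    qed (simp add: outside)
  qed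
  also have "\<dots> = ennreal (A powr p + B powr p) * ennreal (integral\<^sup>L lebesgue (besov_density p w))"
    by (simp add: nn_integral_cmult nn_integral_eq_integral integrable nonneg)
  also have "\<dots> < \<infinity>" by (simp add: ennreal_mult_less_top)
  finally show ?thesis
    by (simp add: besov_space_def q_analytic_zbar_poly besov_norm_finite_iff)
qed

lemma wirtinger_dilation:
  assumes "f differentiable (at (of_real r * z))"
  shows "d_z (\<lambda>z. f (of_real r * z)) z = of_real r * d_z f (of_real r * z)"
    "d_zbar (\<lambda>z. f (of_real r * z)) z = of_real r * d_zbar f (of_real r * z)"
proof -
  have "((\<lambda>z. of_real r * z) has_derivative (\<lambda>v. of_real r * v)) (at z)"
    by (auto intro!: derivative_eq_intros)
  from diff_chain_at[OF this has_derivative_wirtinger[OF assms]]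
  have "((\<lambda>z. f (of_real r * z)) has_derivative
    (\<lambda>v. (of_real r * d_z f (of_real r * z)) * v + (of_real r * d_zbar f (of_real r * z)) * cnj v)) (at z)"
    by (simp add: o_def algebra_simps)
  then show "d_z (\<lambda>z. f (of_real r * z)) z = of_real r * d_z f (of_real r * z)"
    "d_zbar (\<lambda>z. f (of_real r * z)) z = of_real r * d_zbar f (of_real r * z)"
    by (rule has_derivative_imp_wirtinger)+
qed

text \<open>
  The coefficients \<open>r ^ j * h j (r z)\<close> of the dilation are holomorphic on the disc of radius
  \<open>1 / r > 1\<close>, hence accessible to polynomial approximation up to the unit circle.
\<close>

lemma dilation_poly_approx:
  assumes h: "\<And>j. h j holomorphic_on ball 0 1"
    and f: "\<And>z. z \<in> ball 0 1 \<Longrightarrow> f z = zbar_comb n h z"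
    and r: "0 < r" "r < 1" and e: "0 < e"
  obtains P where "zbar_poly n P 0 = f 0"
    "\<And>z. z \<in> ball 0 1 \<Longrightarrow> cmod (of_real r * d_z f (of_real r * z) - d_z (zbar_poly n P) z) \<le> e"
    "\<And>z. z \<in> ball 0 1 \<Longrightarrow> cmod (of_real r * d_zbar f (of_real r * z) - d_zbar (zbar_poly n P) z) \<le> e"
proof -
  define H where "H j z = of_real (r ^ j) * h j (of_real r * z)" for j z
  have in_disc: "of_real r * z \<in> ball 0 1" if "z \<in> ball 0 (1 / r)" for z :: complex
    using that r by (simp add: norm_mult field_simps)
  have H: "H j holomorphic_on ball 0 (1 / r)" for j
  proof -
    have "(h j \<circ> (\<lambda>z. of_real r * z)) holomorphic_on ball 0 (1 / r)"
    proof (rule holomorphic_on_compose_gen[OF _ h])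
      show "(\<lambda>z. of_real r * z) holomorphic_on ball 0 (1 / r)"
        by (intro holomorphic_on_mult holomorphic_on_const holomorphic_on_ident)
      show "(\<lambda>z::complex. of_real r * z) ` ball 0 (1 / r) \<subseteq> ball 0 1"
        using in_disc by blast
    qed
    then show ?thesis
      unfolding H_def by (intro holomorphic_on_mult holomorphic_on_const) (simp add: o_def)
  qed
  have R: "1 < 1 / r" using r by simp
  obtain P where P: "zbar_poly n P 0 = zbar_comb n H 0"
    "\<And>z. z \<in> ball 0 1 \<Longrightarrow> cmod (d_z (zbar_comb n H) z - d_z (zbar_poly n P) z) \<le> e"
    "\<And>z. z \<in> ball 0 1 \<Longrightarrow> cmod (d_zbar (zbar_comb n H) z - d_zbar (zbar_poly n P) z) \<le> e"
    using zbar_comb_poly_approx[where h = H and n = n, OF H R e] by blast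
  have eq: "zbar_comb n H z = f (of_real r * z)" if "z \<in> ball 0 1" for z
  proof -
    have "z \<in> ball 0 (1 / r)" using that R by auto
    then show ?thesis
      using f[OF in_disc, of z] by (simp add: zbar_comb_def H_def power_mult_distrib mult_ac)
  qed
  have d: "d_z (zbar_comb n H) z = of_real r * d_z f (of_real r * z)"
    "d_zbar (zbar_comb n H) z = of_real r * d_zbar f (of_real r * z)" if z: "z \<in> ball 0 1" for z
  proof -
    have rz: "of_real r * z \<in> ball 0 1" using in_disc[of z] R z by auto
    have "zbar_comb n h differentiable (at (of_real r * z))"
      using wirtinger_zbar_comb(1)[OF h open_ball rz] .
    then obtain D where "(zbar_comb n h has_derivative D) (at (of_real r * z))"
      by (auto simp: differentiable_def)
    then have "(f has_derivative D) (at (of_real r * z))"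
      by (rule has_derivative_transform_within_open[OF _ open_ball rz]) (simp add: f)
    then have fd: "f differentiable (at (of_real r * z))" by (auto simp: differentiable_def)
    show "d_z (zbar_comb n H) z = of_real r * d_z f (of_real r * z)"
      "d_zbar (zbar_comb n H) z = of_real r * d_zbar f (of_real r * z)"
      using wirtinger_cong(3,4)[OF open_ball z eq] wirtinger_dilation[OF fd] by simp_all
  qed
  show ?thesis
  proof (rule that)
    show "zbar_poly n P 0 = f 0" using P(1) eq[of 0] by simp
  qed (use P(2,3) d in auto)
qed

theorem theorem2p2:
  fixes q k :: nat and p C r0 :: real and w :: "complex \<Rightarrow> real"
  assumes "q \<ge> 1" and "2 \<le> p"
    and "weight w"
    and "C > 0" and "0 < r0" and "r0 < 1"
    and "\<And>r z. r0 \<le> r \<Longrightarrow> r < 1 \<Longrightarrow> cmod z < r \<Longrightarrow>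
           r ^ k * w (z / complex_of_real r) \<le> C * w z"
  shows "\<forall>f\<in>besov_space q p w. \<forall>\<epsilon>::real. \<epsilon> > 0 \<longrightarrow>
           (\<exists>P. polyanalytic_polynomial P \<and> P \<in> besov_space q p w \<and>
                besov_norm p w (\<lambda>z. f z - P z) < ennreal \<epsilon>)"
proof (intro ballI allI impI)
  fix f and \<epsilon> :: real
  assume f: "f \<in> besov_space q p w" and \<epsilon>: "\<epsilon> > 0"
  define W where "W = besov_density p w"
  have dw: "dilation_weight (besov_density p w) (C / r0 ^ k) r0"
    by (rule dilation_weight_besov_density[OF assms(2-)])
  then interpret dilation_weight W "C / r0 ^ k" r0 by (simp add: W_def)
  have p: "0 < p" using assms(2) by simp
  have fq: "Ck_on q f (ball 0 1)" "\<And>z. z \<in> ball 0 1 \<Longrightarrow> (d_zbar ^^ q) f z = 0"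
    using f by (auto simp: besov_space_def q_analytic_def)
  obtain h where h: "\<And>j. h j holomorphic_on ball 0 1"
    "\<And>z. z \<in> ball 0 1 \<Longrightarrow> f z = zbar_comb q h z"
    using polyanalytic_decomposition[OF open_ball fq] by blast
  obtain q' where q': "q = Suc q'" using assms(1) by (cases q) auto
  have fdiff: "f differentiable (at z)" if "z \<in> ball 0 1" for z
    using fq(1) that by (simp add: q')
  have cont: "continuous_on (ball 0 1) (d_z f)" "continuous_on (ball 0 1) (d_zbar f)"
    using Ck_on_wirtinger[OF open_ball fq(1)[unfolded q']] by (auto dest: Ck_on_imp_continuous_on)
  have fin: "besov_integral p w f < \<infinity>"
    using f by (simp add: besov_space_def besov_norm_finite_iff)
  have fin_z: "(\<integral>\<^sup>+z. ennreal (cmod (d_z f z) powr p) * ennreal (W z) \<partial>lebesgue) < \<infinity>"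
    by (rule le_less_trans[OF _ fin], unfold besov_integral_eq W_def)
       (intro nn_integral_mono mult_right_mono ennreal_leI, auto)
  have fin_zbar: "(\<integral>\<^sup>+z. ennreal (cmod (d_zbar f z) powr p) * ennreal (W z) \<partial>lebesgue) < \<infinity>"
    by (rule le_less_trans[OF _ fin], unfold besov_integral_eq W_def)
       (intro nn_integral_mono mult_right_mono ennreal_leI, auto)
  define M where "M = integral\<^sup>L lebesgue W"
  have M: "0 \<le> M" "(\<integral>\<^sup>+z. ennreal (W z) \<partial>lebesgue) = ennreal M"
    using integrable nonneg by (auto simp: M_def nn_integral_eq_integral)
  \<comment> \<open>The \<open>p\<close>-th power of the seminorm of the error will be at most \<open>2 powr p\<close>
    times the sum of four quantities, each at most \<open>e\<close>: one dilation error and one uniform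
    error for each of the two derivatives.\<close>
  define e where "e = \<epsilon> powr p / (4 * 2 powr p)"
  have e: "0 < e" using \<epsilon> by (simp add: e_def)
  define \<eta> where "\<eta> = (e / (M + 1)) powr (1 / p)"
  have \<eta>: "0 < \<eta>" "\<eta> powr p = e / (M + 1)"
    using e p M by (auto simp: \<eta>_def powr_powr)
  let ?A = "\<lambda>g r z. ennreal (cmod (g z - of_real r * g (of_real r * z)) powr p) * ennreal (W z)"
  have "\<forall>\<^sub>F r in at_left 1. r \<in> {0<..<1::real}"
    by (rule eventually_at_leftI[of 0]) auto
  then have "\<forall>\<^sub>F r in at_left 1. r \<in> {0<..<1} \<and>
      (\<integral>\<^sup>+z. ?A (d_z f) r z \<partial>lebesgue) < ennreal e \<and> (\<integral>\<^sup>+z. ?A (d_zbar f) r z \<partial>lebesgue) < ennreal e"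
    using dilation_Lp_convergence[OF cont(1) p e fin_z] dilation_Lp_convergence[OF cont(2) p e fin_zbar]
    by eventually_elim auto
  then obtain r where r: "0 < r" "r < 1"
    and Tz: "(\<integral>\<^sup>+z. ?A (d_z f) r z \<partial>lebesgue) < ennreal e"
    and Tzbar: "(\<integral>\<^sup>+z. ?A (d_zbar f) r z \<partial>lebesgue) < ennreal e"
    using eventually_happens'[OF trivial_limit_at_left_real] by force
  obtain s where s: "(\<integral>\<^sup>+z. ?A (d_z f) r z \<partial>lebesgue) = ennreal s" "0 \<le> s" "s < e"
    using Tz by (cases "\<integral>\<^sup>+z. ?A (d_z f) r z \<partial>lebesgue") (auto simp: ennreal_less_iff)
  obtain t where t: "(\<integral>\<^sup>+z. ?A (d_zbar f) r z \<partial>lebesgue) = ennreal t" "0 \<le> t" "t < e"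
    using Tzbar by (cases "\<integral>\<^sup>+z. ?A (d_zbar f) r z \<partial>lebesgue") (auto simp: ennreal_less_iff)
  obtain P where P: "zbar_poly q P 0 = f 0"
    "\<And>z. z \<in> ball 0 1 \<Longrightarrow> cmod (of_real r * d_z f (of_real r * z) - d_z (zbar_poly q P) z) \<le> \<eta>"
    "\<And>z. z \<in> ball 0 1 \<Longrightarrow> cmod (of_real r * d_zbar f (of_real r * z) - d_zbar (zbar_poly q P) z) \<le> \<eta>"
    using dilation_poly_approx[OF h r \<eta>(1)] by blast
  let ?g = "\<lambda>z. f z - zbar_poly q P z"
  let ?c = "2 powr p"
  have split: "cmod (a - c) powr p \<le> ?c * (cmod (a - b) powr p + \<eta> powr p)" if "cmod (b - c) \<le> \<eta>" for a b c
  proof -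
    have "cmod (a - c) \<le> cmod (a - b) + \<eta>"
      using norm_triangle_ineq[of "a - b" "b - c"] that by simp
    then have "cmod (a - c) powr p \<le> (cmod (a - b) + \<eta>) powr p"
      using p by (intro powr_mono2) auto
    also have "\<dots> \<le> ?c * (cmod (a - b) powr p + \<eta> powr p)"
      using p \<eta>(1) by (intro powr_add_le_two_powr) auto
    finally show ?thesis .
  qed
  have meas: "(\<lambda>z. ?A g r z) \<in> borel_measurable lebesgue" if g: "continuous_on (ball 0 1) g" for g
  proof -
    define G where "G z = (if z \<in> ball 0 1 then g z - of_real r * g (of_real r * z) else 0)" for z
    have "continuous_on (ball 0 1) (\<lambda>z. g (of_real r * z))"
    proof (rule continuous_on_compose2[OF g])
      show "(\<lambda>z::complex. of_real r * z) ` ball 0 1 \<subseteq> ball 0 1"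
      proof clarsimp
        fix z :: complex assume "cmod z < 1"
        then have "r * cmod z < 1 * 1" using r by (intro mult_strict_mono) auto
        then show "cmod (of_real r * z) < 1" using r by (simp add: norm_mult)
      qed
    qed (intro continuous_intros)
    then have "G \<in> borel_measurable borel"
      unfolding G_def
      by (intro borel_measurable_continuous_on_if continuous_intros g) auto
    then have "(\<lambda>z. ennreal (cmod (G z) powr p)) \<in> borel_measurable borel" by measurable
    then have "(\<lambda>z. ennreal (cmod (G z) powr p)) \<in> borel_measurable lebesgue"
      by (simp add: measurable_completion)
    then have "(\<lambda>z. ennreal (cmod (G z) powr p) * ennreal (W z)) \<in> borel_measurable lebesgue"
      by simp
    moreover have "(\<lambda>z. ennreal (cmod (G z) powr p) * ennreal (W z)) = ?A g r"
      by (auto simp: G_def outside fun_eq_iff)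
    ultimately show ?thesis by simp
  qed
  have "besov_integral p w ?g \<le> (\<integral>\<^sup>+z. ennreal ?c * (?A (d_z f) r z + ?A (d_zbar f) r z +
      ennreal (2 * \<eta> powr p) * ennreal (W z)) \<partial>lebesgue)"
    unfolding besov_integral_eq W_def[symmetric]
  proof (rule nn_integral_mono)
    fix z :: complex
    show "ennreal (cmod (d_z ?g z) powr p + cmod (d_zbar ?g z) powr p) * ennreal (W z) \<le>
      ennreal ?c * (?A (d_z f) r z + ?A (d_zbar f) r z + ennreal (2 * \<eta> powr p) * ennreal (W z))"
    proof (cases "z \<in> ball 0 1")
      case z: True
      note d = wirtinger_diff[OF fdiff[OF z] wirtinger_zbar_poly(3)]
      have "cmod (d_z ?g z) powr p + cmod (d_zbar ?g z) powr p \<le>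
        ?c * (cmod (d_z f z - of_real r * d_z f (of_real r * z)) powr p + 
          cmod (d_zbar f z - of_real r * d_zbar f (of_real r * z)) powr p + 2 * \<eta> powr p)"
        unfolding d using split[OF P(2)[OF z], of "d_z f z"] split[OF P(3)[OF z], of "d_zbar f z"]
        by (simp add: algebra_simps)
      then have "ennreal (cmod (d_z ?g z) powr p + cmod (d_zbar ?g z) powr p) * ennreal (W z) \<le>
        ennreal (?c * (cmod (d_z f z - of_real r * d_z f (of_real r * z)) powr p + 
          cmod (d_zbar f z - of_real r * d_zbar f (of_real r * z)) powr p + 2 * \<eta> powr p)) * ennreal (W z)"
        by (intro mult_right_mono ennreal_leI) auto
      also have "\<dots> = ennreal ?c * (?A (d_z f) r z + ?A (d_zbar f) r z + ennreal (2 * \<eta> powr p) * ennreal (W z))"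
        by (simp add: ennreal_mult ennreal_plus distrib_right mult.assoc)
      finally show ?thesis .
    qed (simp add: outside)
  qed
  also have "\<dots> = ennreal ?c * (ennreal s + ennreal t + ennreal (2 * \<eta> powr p) * ennreal M)"
    using meas[OF cont(1)] meas[OF cont(2)]
    by (simp add: nn_integral_cmult nn_integral_add s(1) t(1) M(2))
  also have "\<dots> = ennreal (?c * (s + t + 2 * \<eta> powr p * M))"
    using s t M(1) by (simp add: ennreal_mult ennreal_plus)
  finally have le: "besov_integral p w ?g \<le> ennreal (?c * (s + t + 2 * \<eta> powr p * M))" .
  have "\<eta> powr p * M \<le> e"
  proof -
    have "\<eta> powr p * M \<le> e / (M + 1) * (M + 1)"
      unfolding \<eta>(2) using M(1) e by (intro mult_left_mono) auto
    also have "\<dots> = e" using M(1) by simp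
    finally show ?thesis .
  qed
  then have "s + t + 2 * \<eta> powr p * M < 4 * e" using s t by simp
  then have "?c * (s + t + 2 * \<eta> powr p * M) < ?c * (4 * e)" by simp
  also have "\<dots> = \<epsilon> powr p" by (simp add: e_def)
  finally have "besov_norm p w ?g < ennreal \<epsilon>"
    using P(1) s t M(1) by (intro besov_norm_less[OF p \<epsilon> _ _ _ le]) auto
  then show "\<exists>P. polyanalytic_polynomial P \<and> P \<in> besov_space q p w \<and>
                besov_norm p w (\<lambda>z. f z - P z) < ennreal \<epsilon>"
    using polyanalytic_polynomial_zbar_poly zbar_poly_in_besov_space[OF dw p] by blast
qed

end
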